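(* Let $\ell\ge0$ be an integer, let ${\bf y}(t)=\varphi_\ell(-tA){\bf v}$ and $\widehat{\bf y}_{\ell,k}(t)=V_k\varphi_\ell(-tT_k)\beta{\bf e}_1$, and let $\widehat\Gamma$ be a closed contour enclosing the spectra of $-tA$ and $-tT_k$ such that $\varphi_\ell$ is analytic on and inside $\widehat\Gamma$. Denote by $\widehat{\bf e}_{\ell,k}(t)={\bf y}(t)-\widehat{\bf y}_{\ell,k}(t)$ the error and by $\widehat{\bf r}_{\ell,k}(t)$ the residual of $\widehat{\bf y}_{\ell,k}(t)$. Assume that ${\bf e}_{k}^{\mathrm{H}}\varphi_{\ell}(-tT_{k})\beta{\bf e}_{1}\neq 0$, and define $$ f_{T_{k}}(z)=t\varphi_{\ell}(z)\cdot\frac{{\bf e}_{k}^{\mathrm{H}}(zI+tT_{k})^{-1}\beta{\bf e}_{1}}{{\bf e}_{k}^{\mathrm{H}}\varphi_{\ell}(-tT_{k})\beta{\bf e}_{1}}. $$ Then $$ \widehat{\bf e}_{\ell,k}(t)=\left(\frac{1}{2\pi{\bf i}}\int_{\widehat\Gamma}f_{T_{k}}(z)(zI+tA)^{-1}dz\right)\widehat{\bf r}_{\ell,k}(t) $$ and $$ \|\widehat{\bf e}_{\ell,k}(t)\|_2\leq\Big\|\frac{1}{2\pi{\bf i}}\int_{\widehat\Gamma}f_{T_{k}}(z)(zI+tA)^{-1}dz\Big\|_2\cdot\|\widehat{\bf r}_{\ell,k}(t)\|_2. $$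
   Context: The $\varphi$-functions are $\varphi_0(z)=e^z$ and $\varphi_\ell(z)=\frac{1}{(\ell-1)!}\int_0^1 e^{(1-\theta)z}\theta^{\ell-1}d\theta$ for $\ell\ge1$, $z\in\mathbb C$ (extended to square matrices as matrix functions). $A$ is an $n\times n$ matrix, $t>0$, the spectrum of $-tA$ lies in the (closed) left half plane, and ${\bf v}$ is a nonzero vector with $\beta=\|{\bf v}\|_2$. The $k$-step Arnoldi process started with ${\bf v}_1={\bf v}/\beta$ is assumed to produce $V_{k+1}=[{\bf v}_1,\dots,{\bf v}_{k+1}]=[V_k,{\bf v}_{k+1}]$ with orthonormal columns (spanning the Krylov subspace $\mathrm{span}\{{\bf v}_1,A{\bf v}_1,\dots,A^k{\bf v}_1\}$), a $k\times k$ upper Hessenberg matrix $H_k$ and a real scalar $h_{k+1,k}$ with $$AV_k=V_kH_k+h_{k+1,k}{\bf v}_{k+1}{\bf e}_k^{\mathrm{H}}.$$ Here ${\bf e}_j$ is the $j$-th column of the $k\times k$ identity matrix, $(\cdot)^{\mathrm{H}}$ is the conjugate transpose, $(\cdot)^{-\mathrm{H}}$ is the inverse of the conjugate transpose, ${\bf i}^2=-1$, and $'$ denotes $d/dt$. Contours are positively oriented. The parameter $\gamma$ is a nonzero real number such that $I+\gamma H_k$ is nonsingular, and $$T_k=H_k+\gamma h_{k+1,k}^2(I+\gamma H_k)^{-\mathrm{H}}{\bf e}_k{\bf e}_k^{\mathrm{H}}.$$ The residual is defined, for $\ell\ge1$, by $$\widehat{\bf r}_{\ell,k}(t)=-A\widehat{\bf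 y}_{\ell,k}(t)-\frac{\ell}{t}\widehat{\bf y}_{\ell,k}(t)+\frac{1}{t(\ell-1)!}{\bf v}-\widehat{\bf y}_{\ell,k}'(t),$$ and for $\ell=0$ by $\widehat{\bf r}_{0,k}(t)=-A\widehat{\bf y}_{0,k}(t)-\widehat{\bf y}_{0,k}'(t)$. *)

theory Defs
  imports "HOL-Complex_Analysis.Complex_Analysis"
begin

subsection \<open>Complex matrices\<close>

text \<open>
  The \<open>k\<close>-dimensional index set is a finite linearly ordered type \<open>'k\<close>, so that its first and last
  elements and the Hessenberg shape make sense. The norm on \<open>complex ^ 'n\<close> is the Euclidean norm,
  hence \<open>onorm ((*v) M)\<close> is the spectral norm of \<open>M\<close>. Note that \<open>mat z\<close> is \<open>z I\<close>.
\<close>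

definition ctranspose :: "complex ^ 'c ^ 'r \<Rightarrow> complex ^ 'r ^ 'c" where
  "ctranspose M = (\<chi> i j. cnj (M $ j $ i))"

definition hinner :: "complex ^ 'n \<Rightarrow> complex ^ 'n \<Rightarrow> complex" where  \<comment> \<open>\<open>x\<^sup>H y\<close>\<close>
  "hinner x y = (\<Sum>i\<in>UNIV. cnj (x $ i) * y $ i)"

definition outer :: "complex ^ 'r \<Rightarrow> complex ^ 'c \<Rightarrow> complex ^ 'c ^ 'r" where  \<comment> \<open>\<open>x y\<^sup>H\<close>\<close>
  "outer x y = (\<chi> i j. x $ i * cnj (y $ j))"

definition cscale :: "complex \<Rightarrow> complex ^ 'c ^ 'r \<Rightarrow> complex ^ 'c ^ 'r" (infixr "*\<^sub>m" 75) where
  "c *\<^sub>m M = (\<chi> i j. c * M $ i $ j)"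

definition e_first :: "complex ^ ('k :: {finite, linorder})" where
  "e_first = axis (Min UNIV) 1"

definition e_last :: "complex ^ ('k :: {finite, linorder})" where
  "e_last = axis (Max UNIV) 1"

text \<open>\<open>card {..i}\<close> is the position (counted from 1) of the index \<open>i\<close>.\<close>
definition upper_hessenberg :: "complex ^ ('k :: {finite, linorder}) ^ ('k :: {finite, linorder}) \<Rightarrow> bool" where
  "upper_hessenberg H \<longleftrightarrow> (\<forall>i j. card {..i} > card {..j} + 1 \<longrightarrow> H $ i $ j = 0)"

definition mat_spectrum :: "complex ^ 'n ^ 'n \<Rightarrow> complex set" where
  "mat_spectrum M = {z. \<exists>x. x \<noteq> 0 \<and> M *v x = z *s x}"

text \<open>The library's \<open>^\<close> acts entrywise on vectors and matrices, hence a separate matrix power.\<close>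
definition matpow :: "complex ^ 'n ^ 'n \<Rightarrow> nat \<Rightarrow> complex ^ 'n ^ 'n" where
  "matpow M j = ((\<lambda>N. M ** N) ^^ j) (mat 1)"

text \<open>
  The matrix function \<open>f(M)\<close> of an entire function \<open>f\<close>: its Taylor series at 0, evaluated at \<open>M\<close>.
\<close>
definition matfun :: "(complex \<Rightarrow> complex) \<Rightarrow> complex ^ 'n ^ 'n \<Rightarrow> complex ^ 'n ^ 'n" where
  "matfun f M = (\<Sum>j. ((deriv ^^ j) f 0 / fact j) *\<^sub>m matpow M j)"

definition matrix_contour_integral ::
    "(real \<Rightarrow> complex) \<Rightarrow> (complex \<Rightarrow> complex ^ 'c ^ 'r) \<Rightarrow> complex ^ 'c ^ 'r" where
  "matrix_contour_integral g F = (\<chi> i j. contour_integral g (\<lambda>z. F z $ i $ j))"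

text \<open>Enclosing a set includes positive orientation: the contour winds exactly once around each point.\<close>
definition encloses :: "(real \<Rightarrow> complex) \<Rightarrow> complex set \<Rightarrow> bool" where
  "encloses g S \<longleftrightarrow> (\<forall>z\<in>S. z \<notin> path_image g \<and> winding_number g z = 1)"

subsection \<open>The Arnoldi process and the residual\<close>

text \<open>
  The outcome of \<open>k\<close> steps (\<open>k = CARD('k)\<close>) of the Arnoldi process for \<open>A\<close> started with \<open>u\<close>:
  \<open>[V, w]\<close> is the matrix \<open>V\<^sub>k\<^sub>+\<^sub>1\<close>, with \<open>w\<close> its last column, and \<open>h\<close> is the scalar \<open>h\<^sub>k\<^sub>+\<^sub>1\<^sub>,\<^sub>k\<close>.
\<close>
definition arnoldi ::
    "complex ^ 'n ^ 'n \<Rightarrow> complex ^ 'n \<Rightarrow> complex ^ ('k :: {finite, linorder}) ^ 'n \<Rightarrow> complex ^ 'n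
      \<Rightarrow> complex ^ ('k :: {finite, linorder}) ^ ('k :: {finite, linorder}) \<Rightarrow> real \<Rightarrow> bool" where
  "arnoldi A u V w H h \<longleftrightarrow>
     column (Min UNIV) V = u \<and>
     ctranspose V ** V = mat 1 \<and> ctranspose V *v w = 0 \<and> norm w = 1 \<and>
     vec.span (insert w (columns V)) = vec.span {matpow A j *v u | j. j \<le> CARD('k)} \<and>
     upper_hessenberg H \<and>
     A ** V = V ** H + h *\<^sub>R outer w e_last"

definition phi :: "nat \<Rightarrow> complex \<Rightarrow> complex" where
  "phi l z = (if l = 0 then exp z
     else 1 / fact (l - 1) *
       integral {0..1} (\<lambda>\<theta>::real. exp ((1 - of_real \<theta>) * z) * of_real \<theta> ^ (l - 1)))"

definition residual ::
    "nat \<Rightarrow> complex ^ 'n ^ 'n \<Rightarrow> complex ^ 'n \<Rightarrow> (real \<Rightarrow> complex ^ 'n) \<Rightarrow> real \<Rightarrow> complex ^ 'n" where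
  "residual l A v y t =
     (if l = 0 then - (A *v y t) - vector_derivative y (at t)
      else - (A *v y t) - (real l / t) *\<^sub>R y t + (1 / (t * fact (l - 1))) *\<^sub>R v
           - vector_derivative y (at t))"

definition f_fun ::
    "nat \<Rightarrow> real \<Rightarrow> real \<Rightarrow> complex ^ ('k :: {finite, linorder}) ^ ('k :: {finite, linorder}) \<Rightarrow> complex \<Rightarrow> complex" where
  "f_fun l t \<beta> T z = of_real t * phi l z *
     (hinner e_last (matrix_inv (mat z + t *\<^sub>R T) *v (\<beta> *\<^sub>R e_first)) /
      hinner e_last (matfun (phi l) (- (t *\<^sub>R T)) *v (\<beta> *\<^sub>R e_first)))"

end

theory Submission
  imports Defs
begin

text \<open>
  Both matrix functions are Cauchy integrals of their resolvents over the given contour. Since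
  \<open>A V - V T = p e\<^sub>k\<^sup>H\<close> has rank one, the two resolvents differ, after multiplication with \<open>V\<close>, by
  \<open>-t (e\<^sub>k\<^sup>H (z I + t T)\<^sup>-\<^sup>1 \<beta> e\<^sub>1) (z I + t A)\<^sup>-\<^sup>1 p\<close>. The differential equation for
  \<open>s \<mapsto> \<phi>\<^sub>l(-s T)\<close> shows that the residual is the multiple \<open>-(e\<^sub>k\<^sup>H \<phi>\<^sub>l(-t T) \<beta> e\<^sub>1) p\<close> of the same \<open>p\<close>.

  The Cauchy formula for the Taylor series \<open>f(M)\<close> is obtained on a circle of radius larger than the
  norm of \<open>M\<close>, where the resolvent has a Neumann expansion, and is carried over to other contours
  by the residue theorem, because both contours wind once around every eigenvalue.
\<close>

unbundle no fps_syntax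

subsection \<open>Resolvents and the Cauchy formula for matrix functions\<close>

text \<open>For \<open>M = - (t *\<^sub>R A)\<close> this is (zI + tA)^-1. The lemmas below study
  scalar components of \<open>resolvent M z *v x\<close>, so that complex analysis in one variable
  applies.\<close>

definition resolvent :: "complex ^ 'n ^ 'n \<Rightarrow> complex \<Rightarrow> complex ^ 'n ^ 'n" where
  "resolvent M z = matrix_inv (mat z - M)"

lemma mat_vector_mul: "mat z *v x = z *s (x :: 'a::semiring_1 ^ 'n)"
  by (simp add: vec_eq_iff matrix_vector_mult_def mat_def if_distrib[of "\<lambda>a. a * _"] cong: if_cong)

lemma invertible_iff_notin_mat_spectrum:
  "invertible (mat z - M) \<longleftrightarrow> z \<notin> mat_spectrum M"
  unfolding invertible_left_inverse matrix_left_invertible_ker mat_spectrum_def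
  by (auto simp: matrix_vector_mult_diff_rdistrib mat_vector_mul)

lemma matrix_inv_mult:
  fixes M :: "'a::semiring_1 ^ 'm ^ 'n"
  assumes "invertible M"
  shows "M ** matrix_inv M = mat 1" "matrix_inv M ** M = mat 1"
  using assms someI_ex[of "\<lambda>N. M ** N = mat 1 \<and> N ** M = mat 1"]
  unfolding invertible_def matrix_inv_def by auto

lemma resolvent_cancel:
  assumes "z \<notin> mat_spectrum M"
  shows "(mat z - M) *v (resolvent M z *v x) = x" "resolvent M z *v ((mat z - M) *v x) = x"
  using matrix_inv_mult[of "mat z - M"] assms
  by (auto simp: invertible_iff_notin_mat_spectrum resolvent_def matrix_vector_mul_assoc)

lemma resolvent_eq:
  assumes "z \<notin> mat_spectrum M"
  shows "z *s (resolvent M z *v x) = x + M *v (resolvent M z *v x)"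
  using resolvent_cancel(1)[OF assms, of x]
  by (simp add: matrix_vector_mult_diff_rdistrib mat_vector_mul algebra_simps)

section \<open>Holomorphy of the resolvent and finiteness of the spectrum\<close>

lemma holomorphic_on_det:
  fixes F :: "complex \<Rightarrow> complex ^ 'n ^ 'n"
  assumes "\<And>i j. (\<lambda>z. F z $ i $ j) holomorphic_on S"
  shows "(\<lambda>z. det (F z)) holomorphic_on S"
  unfolding det_def by (intro holomorphic_intros assms)

lemma det_mat_minus_eq_0_iff: "det (mat z - M) = 0 \<longleftrightarrow> z \<in> mat_spectrum M"
  using invertible_det_nz[of "mat z - M"] invertible_iff_notin_mat_spectrum[of z M] by blast

lemma holomorphic_on_mat_minus: "(\<lambda>z. (mat z - M) $ i $ j) holomorphic_on S"
  by (cases "i = j") (auto simp: mat_def intro!: holomorphic_intros)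

lemma holomorphic_on_det_mat_minus: "(\<lambda>z. det (mat z - M)) holomorphic_on S"
  by (intro holomorphic_on_det holomorphic_on_mat_minus)

text \<open>By Cramer's rule each component is a quotient of two determinants that are entire in z,
  and the denominator vanishes exactly on the spectrum.\<close>

lemma holomorphic_on_resolvent:
  "(\<lambda>z. (resolvent M z *v x) $ i) holomorphic_on - mat_spectrum M"
proof -
  \<comment> \<open>This is zI - M with column \<open>i\<close> replaced by \<open>x\<close>, the
    numerator matrix of Cramer's rule.\<close>
  let ?B = "\<lambda>z. \<chi> a b. if b = i then x $ a else (mat z - M) $ a $ b"
  have "(\<lambda>z. det (?B z)) holomorphic_on - mat_spectrum M"
  proof (rule holomorphic_on_det)
    show "(\<lambda>z. ?B z $ a $ b) holomorphic_on - mat_spectrum M" for a b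
      by (cases "b = i") (use holomorphic_on_mat_minus in auto)
  qed
  then have "(\<lambda>z. det (?B z) / det (mat z - M)) holomorphic_on - mat_spectrum M"
    by (intro holomorphic_on_divide holomorphic_on_det_mat_minus) (auto simp: det_mat_minus_eq_0_iff)
  moreover have "(resolvent M z *v x) $ i = det (?B z) / det (mat z - M)" if "z \<notin> mat_spectrum M" for z
    using cramer[of "mat z - M" "resolvent M z *v x" x] that
    by (simp add: det_mat_minus_eq_0_iff resolvent_cancel(1))
  ultimately show ?thesis
    by (subst holomorphic_cong[OF refl]) auto
qed

lemma norm_smult: "norm (c *s (x :: complex ^ 'n)) = cmod c * norm x"
  unfolding norm_vec_def by (simp add: norm_mult L2_set_right_distrib)

lemma mat_spectrum_bounded:
  assumes "z \<in> mat_spectrum M"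
  shows "cmod z \<le> onorm ((*v) M)"
proof -
  obtain x where x: "x \<noteq> 0" "M *v x = z *s x"
    using assms by (auto simp: mat_spectrum_def)
  have "cmod z * norm x \<le> onorm ((*v) M) * norm x"
    using onorm[OF matrix_vector_mul_bounded_linear, of M x] x by (simp add: norm_smult)
  then show ?thesis using x by simp
qed

text \<open>Eigenvalues are zeros of the entire function det(zI - M) in a compact disc, and a
  nonconstant one has only finitely many there.\<close>

lemma finite_mat_spectrum: "finite (mat_spectrum (M :: complex ^ 'n ^ 'n))"
proof (cases "(\<lambda>z. det (mat z - M)) constant_on UNIV")
  case True
  then obtain c where c: "\<And>z. det (mat z - M) = c" by (auto simp: constant_on_def)
  \<comment> \<open>A point outside the disc that contains all eigenvalues; it shows that a constant
    determinant is nonzero.\<close>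
  let ?z = "complex_of_real (onorm ((*v) M) + 1)"
  have "0 \<le> onorm ((*v) M)" by (simp add: onorm_pos_le)
  then have "\<not> cmod ?z \<le> onorm ((*v) M)" unfolding norm_of_real by linarith
  then have "c \<noteq> 0"
    using mat_spectrum_bounded c det_mat_minus_eq_0_iff by metis
  then have "mat_spectrum M = {}"
    using c by (auto simp flip: det_mat_minus_eq_0_iff)
  then show ?thesis by simp
next
  case False
  let ?K = "cball 0 (onorm ((*v) M))"
  have "finite {z \<in> ?K. det (mat z - M) = 0}"
    by (intro holomorphic_compact_finite_zeros[where S = UNIV] holomorphic_on_det_mat_minus False) auto
  moreover have "mat_spectrum M \<subseteq> {z \<in> ?K. det (mat z - M) = 0}"
    using mat_spectrum_bounded by (auto simp: det_mat_minus_eq_0_iff)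
  ultimately show ?thesis by (rule rev_finite_subset)
qed

text \<open>The vector y = \<open>resolvent M z *v x\<close> satisfies z y = x + M y; taking norms
  and solving for |y| gives the bound.\<close>

lemma norm_resolvent_le:
  assumes "onorm ((*v) M) < cmod z"
  shows "norm (resolvent M z *v x) \<le> norm x / (cmod z - onorm ((*v) M))"
proof -
  let ?y = "resolvent M z *v x"
  have "z \<notin> mat_spectrum M" using assms mat_spectrum_bounded by fastforce
  have "cmod z * norm ?y = norm (x + M *v ?y)"
    using resolvent_eq[OF \<open>z \<notin> mat_spectrum M\<close>, of x] by (metis norm_smult)
  also have "\<dots> \<le> norm x + onorm ((*v) M) * norm ?y"
    using norm_triangle_ineq[of x "M *v ?y"] onorm[OF matrix_vector_mul_bounded_linear, of M ?y] by linarith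
  finally have "norm ?y * (cmod z - onorm ((*v) M)) \<le> norm x" by (simp add: algebra_simps)
  then show ?thesis using assms by (simp add: pos_le_divide_eq)
qed

section \<open>Matrix powers, the Neumann expansion and Taylor series on a circle\<close>

lemma matpow_0 [simp]: "matpow M 0 = mat 1"
  by (simp add: matpow_def)

lemma matpow_Suc [simp]: "matpow M (Suc j) = M ** matpow M j"
  by (simp add: matpow_def)

lemma matpow_commute: "matpow M j *v (M *v x) = M *v (matpow M j *v x)"
  by (induction j) (simp_all flip: matrix_vector_mul_assoc)

lemma norm_matpow_le: "norm (matpow M j *v x) \<le> onorm ((*v) M) ^ j * norm x"
proof (induction j)
  case (Suc j)
  have "norm (matpow M (Suc j) *v x) \<le> onorm ((*v) M) * norm (matpow M j *v x)"
    using onorm[OF matrix_vector_mul_bounded_linear, of M "matpow M j *v x"]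
    by (simp add: matrix_vector_mul_assoc)
  also have "\<dots> \<le> onorm ((*v) M) * (onorm ((*v) M) ^ j * norm x)"
    by (intro mult_left_mono Suc) (simp add: onorm_pos_le)
  finally show ?case by (simp add: mult.assoc)
qed simp

text \<open>The identity y = (x + M y) / z is iterated N times. Keeping the exact remainder avoids
  any convergence argument for a matrix series.\<close>

lemma resolvent_Neumann_remainder:
  assumes "z \<notin> mat_spectrum M" "z \<noteq> 0"
  shows "resolvent M z *v x = (\<Sum>j<N. (1 / z ^ Suc j) *s (matpow M j *v x))
           + (1 / z ^ N) *s (matpow M N *v (resolvent M z *v x))"
proof (induction N)
  case (Suc N)
  let ?y = "resolvent M z *v x"
  have "(1 / z ^ N) *s (matpow M N *v ?y) = (1 / z ^ Suc N) *s (matpow M N *v (z *s ?y))"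
    using assms(2) by (simp add: matrix_vector_mult_scaleR vec.scale vector_smult_assoc)
  also have "\<dots> = (1 / z ^ Suc N) *s (matpow M N *v x) + (1 / z ^ Suc N) *s (matpow M (Suc N) *v ?y)"
    by (simp add: resolvent_eq[OF assms(1)] matrix_vector_right_distrib vector_add_ldistrib matpow_commute
        flip: matrix_vector_mul_assoc)
  finally show ?case by (subst Suc) (simp add: add.assoc)
qed simp

text \<open>The set \<open>S\<close> admits singularities of \<open>f\<close> itself: in the final
  theorem \<open>f\<close> contains the resolvent of -tT, and \<open>S\<close> is the spectrum of
  -tT. For entire \<open>f\<close> it is empty.\<close>

lemma contour_integrable_resolvent:
  fixes M :: "complex ^ 'n ^ 'n"
  assumes "finite S" "f holomorphic_on - S"
    and "valid_path g" "path_image g \<inter> mat_spectrum M = {}" "path_image g \<inter> S = {}"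
  shows "(\<lambda>z. f z * (resolvent M z *v x) $ i) contour_integrable_on g"
proof (rule contour_integrable_holomorphic_simple)
  show "(\<lambda>z. f z * (resolvent M z *v x) $ i) holomorphic_on - (mat_spectrum M \<union> S)"
    using assms(2)
    by (intro holomorphic_intros holomorphic_on_subset[OF holomorphic_on_resolvent]) (auto elim: holomorphic_on_subset)
  show "open (- (mat_spectrum M \<union> S))"
    using assms(1) by (intro open_Compl finite_imp_closed) (simp add: finite_mat_spectrum)
  show "path_image g \<subseteq> - (mat_spectrum M \<union> S)"
    using assms(4,5) by auto
qed (rule assms(3))

text \<open>Under the integral, the truncated Neumann expansion yields the Taylor coefficients by
  Cauchy's formula for derivatives, and on a circle of radius above the operator norm the remainder
  tends to 0.\<close>

lemma circle_integral_resolvent_sums: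
  fixes M :: "complex ^ 'n ^ 'n"
  assumes f: "f holomorphic_on UNIV" and r: "onorm ((*v) M) < r"
  shows "(\<lambda>j. (deriv ^^ j) f 0 / fact j * (matpow M j *v x) $ i) sums
    (1 / (2 * of_real pi * \<i>) * contour_integral (circlepath 0 r) (\<lambda>z. f z * (resolvent M z *v x) $ i))"
proof -
  let ?K = "onorm ((*v) M)" and ?C = "circlepath 0 r" and ?R = "\<lambda>z. resolvent M z *v x"
  define a where "a j = (deriv ^^ j) f 0 / fact j * (matpow M j *v x) $ i" for j
  define I where "I = contour_integral ?C (\<lambda>z. f z * ?R z $ i)"
  have K: "0 \<le> ?K" by (simp add: onorm_pos_le)
  with r have "0 < r" by simp
  have spec: "z \<notin> mat_spectrum M" "z \<noteq> 0" if "cmod z = r" for z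
    using that mat_spectrum_bounded[of z M] r K by auto
  have "continuous_on (sphere 0 r) f"
    using f holomorphic_on_imp_continuous_on continuous_on_subset by blast
  then have "bounded (f ` sphere 0 r)"
    by (intro compact_imp_bounded compact_continuous_image) auto
  then obtain B where "\<forall>w\<in>f ` sphere 0 r. cmod w \<le> B"
    unfolding bounded_iff by blast
  then have B: "cmod (f z) \<le> B" if "cmod z = r" for z
    using that by auto
  have "0 \<le> B" using order_trans[OF norm_ge_zero B[of "of_real r"]] \<open>0 < r\<close> by simp
  have int: "(\<lambda>z. f z * ?R z $ i) contour_integrable_on ?C"
    using f spec \<open>0 < r\<close>
    by (intro contour_integrable_resolvent[where S = "{}"]) (auto elim: holomorphic_on_subset)
  have Cauchy: "((\<lambda>z. f z / z ^ Suc j * c) has_contour_integral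
      2 * of_real pi * \<i> * ((deriv ^^ j) f 0 / fact j * c)) ?C" for j c
  proof -
    have "((\<lambda>z. f z / (z - 0) ^ Suc j) has_contour_integral 2 * pi * \<i> / fact j * (deriv ^^ j) f 0) ?C"
      using f \<open>0 < r\<close> holomorphic_on_imp_continuous_on
      by (intro Cauchy_has_contour_integral_higher_derivative_circlepath)
        (auto intro: holomorphic_on_subset continuous_on_subset)
    from has_contour_integral_rmul[OF this, of c] show ?thesis
      by (simp add: mult_ac)
  qed
  \<comment> \<open>Here \<open>B\<close> bounds \<open>f\<close> on the circle,
    \<open>norm x / (r - ?K)\<close> bounds the resolvent, and \<open>2 * pi * r\<close> is the
    length of the circle. The powers of \<open>M\<close> and of 1/z combine to the geometric
    factor.\<close>
  have rem: "cmod (I - 2 * of_real pi * \<i> * (\<Sum>j<N. a j))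
      \<le> B * norm x / (r - ?K) * (2 * pi * r) * (?K / r) ^ N" for N
  proof -
    have "((\<lambda>z. f z * ?R z $ i - (\<Sum>j<N. f z / z ^ Suc j * (matpow M j *v x) $ i)) has_contour_integral
        I - (\<Sum>j<N. 2 * of_real pi * \<i> * a j)) ?C"
      unfolding I_def a_def
      by (intro has_contour_integral_diff has_contour_integral_sum Cauchy has_contour_integral_integral int) simp
    moreover have "f z * ?R z $ i - (\<Sum>j<N. f z / z ^ Suc j * (matpow M j *v x) $ i)
        = f z * (1 / z ^ N) * (matpow M N *v ?R z) $ i" if "cmod z = r" for z
    proof -
      have "?R z $ i = (\<Sum>j<N. 1 / z ^ Suc j * (matpow M j *v x) $ i) + 1 / z ^ N * (matpow M N *v ?R z) $ i"
        by (subst resolvent_Neumann_remainder[OF spec[OF that], of x N]) simp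
      then have "f z * ?R z $ i = (\<Sum>j<N. f z * (1 / z ^ Suc j * (matpow M j *v x) $ i))
          + f z * (1 / z ^ N * (matpow M N *v ?R z) $ i)"
        by (simp only: distrib_left sum_distrib_left)
      then show ?thesis by (simp add: mult.assoc)
    qed
    moreover have "path_image ?C = sphere 0 r" using \<open>0 < r\<close> by simp
    ultimately have "((\<lambda>z. f z * (1 / z ^ N) * (matpow M N *v ?R z) $ i) has_contour_integral
        I - (\<Sum>j<N. 2 * of_real pi * \<i> * a j)) ?C"
      by (metis (no_types, lifting) has_contour_integral_eq mem_sphere_0)
    then have "cmod (I - (\<Sum>j<N. 2 * of_real pi * \<i> * a j))
        \<le> B * (1 / r ^ N) * (?K ^ N * (norm x / (r - ?K))) * (2 * pi * r)"
    proof (rule has_contour_integral_bound_circlepath)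
      show "0 \<le> B * (1 / r ^ N) * (?K ^ N * (norm x / (r - ?K)))"
        using \<open>0 \<le> B\<close> \<open>0 < r\<close> r K by auto
    next
      fix z assume "cmod (z - 0) = r"
      then have z: "cmod z = r" by simp
      have "cmod ((matpow M N *v ?R z) $ i) \<le> norm (matpow M N *v ?R z)" by (rule Finite_Cartesian_Product.norm_nth_le)
      also have "\<dots> \<le> ?K ^ N * norm (?R z)" by (rule norm_matpow_le)
      also have "\<dots> \<le> ?K ^ N * (norm x / (r - ?K))"
        using norm_resolvent_le[of M z x] z r K by (intro mult_left_mono) auto
      finally have "cmod ((matpow M N *v ?R z) $ i) \<le> ?K ^ N * (norm x / (r - ?K))" .
      moreover have "cmod (f z * (1 / z ^ N)) \<le> B * (1 / r ^ N)"
        using B[OF z] z \<open>0 < r\<close> by (simp add: norm_mult norm_divide norm_power divide_right_mono)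
      ultimately show "cmod (f z * (1 / z ^ N) * (matpow M N *v ?R z) $ i)
          \<le> B * (1 / r ^ N) * (?K ^ N * (norm x / (r - ?K)))"
        using \<open>0 \<le> B\<close> \<open>0 < r\<close> unfolding norm_mult[of "f z * (1 / z ^ N)"] by (intro mult_mono) auto
    qed (rule \<open>0 < r\<close>)
    moreover have "B * (1 / r ^ N) * (?K ^ N * (norm x / (r - ?K))) * (2 * pi * r)
        = B * norm x / (r - ?K) * (2 * pi * r) * (?K / r) ^ N"
      by (simp add: power_divide mult.commute mult.left_commute)
    ultimately show ?thesis
      by (simp only: sum_distrib_left)
  qed
  have "(\<lambda>N. B * norm x / (r - ?K) * (2 * pi * r) * (?K / r) ^ N) \<longlonglongrightarrow> 0"
    using r K by (intro tendsto_mult_right_zero LIMSEQ_power_zero) auto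
  then have "(\<lambda>N. I - 2 * of_real pi * \<i> * (\<Sum>j<N. a j)) \<longlonglongrightarrow> 0"
    by (intro Lim_null_comparison[OF always_eventually[OF allI[OF rem]]])
  from tendsto_diff[OF tendsto_const[of I] this]
  have "(\<lambda>N. 2 * of_real pi * \<i> * (\<Sum>j<N. a j)) \<longlonglongrightarrow> I" by simp
  from tendsto_mult_left[OF this, of "1 / (2 * of_real pi * \<i>)"]
  show ?thesis unfolding sums_def a_def I_def by simp
qed

text \<open>All singularities of the integrand are eigenvalues of \<open>M\<close>, around which
  both contours wind once, so both integrals equal the same sum of residues. The residues are never
  computed.\<close>

lemma contour_integral_enclosing_eq_circle:
  fixes M :: "complex ^ 'n ^ 'n"
  assumes f: "f holomorphic_on UNIV" and r: "onorm ((*v) M) < r"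
    and g: "valid_path g" "pathfinish g = pathstart g" "encloses g (mat_spectrum M)"
  shows "contour_integral g (\<lambda>z. f z * (resolvent M z *v x) $ i)
       = contour_integral (circlepath 0 r) (\<lambda>z. f z * (resolvent M z *v x) $ i)"
proof -
  let ?F = "\<lambda>z. f z * (resolvent M z *v x) $ i"
  have holo: "?F holomorphic_on UNIV - mat_spectrum M"
    unfolding Compl_eq_Diff_UNIV[symmetric]
    by (intro holomorphic_intros holomorphic_on_resolvent holomorphic_on_subset[OF f]) auto
  have residues: "contour_integral p ?F = 2 * pi * \<i> * (\<Sum>z\<in>mat_spectrum M. residue ?F z)"
    if p: "valid_path p" "pathfinish p = pathstart p" "encloses p (mat_spectrum M)" for p
  proof -
    have "contour_integral p ?F = 2 * pi * \<i> * (\<Sum>z\<in>mat_spectrum M. winding_number p z * residue ?F z)"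
      using p by (intro Residue_theorem[where S = UNIV] holo finite_mat_spectrum) (auto simp: encloses_def)
    then show ?thesis using p(3) by (simp add: encloses_def)
  qed
  have "0 < r" using r onorm_pos_le[OF matrix_vector_mul_bounded_linear, of M] by linarith
  have "encloses (circlepath 0 r) (mat_spectrum M)"
    using mat_spectrum_bounded[of _ M] r \<open>0 < r\<close>
    by (force simp: encloses_def intro!: winding_number_circlepath)
  then show ?thesis using residues g by simp
qed

lemma smult_matrix_vector: "(c *\<^sub>m M) *v x = c *s (M *v x)"
  by (simp add: vec_eq_iff matrix_vector_mult_def cscale_def sum_distrib_left mult.assoc)

text \<open>\<open>matfun\<close> is defined by an infinite sum whose convergence has to be
  established. It follows entry by entry from the circle integrals, with unit vectors in place of
  \<open>x\<close>.\<close>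

lemma matfun_sums:
  fixes M :: "complex ^ 'n ^ 'n"
  assumes f: "f holomorphic_on UNIV"
  shows "(\<lambda>j. ((deriv ^^ j) f 0 / fact j) *s (matpow M j *v x)) sums (matfun f M *v x)"
proof -
  let ?a = "\<lambda>j. (deriv ^^ j) f 0 / fact j"
  let ?r = "onorm ((*v) M) + 1"
  define L where "L a b = 1 / (2 * of_real pi * \<i>) *
    contour_integral (circlepath 0 ?r) (\<lambda>z. f z * (resolvent M z *v axis b 1) $ a)" for a b
  have L: "(\<lambda>j. (?a j *\<^sub>m matpow M j) $ a $ b) sums L a b" for a b
  proof -
    have "(?a j *\<^sub>m matpow M j) $ a $ b = ?a j * (matpow M j *v axis b 1) $ a" for j
      by (simp add: cscale_def matrix_vector_mult_def axis_def if_distrib[of "\<lambda>a. _ * a"] cong: if_cong)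
    then show ?thesis
      unfolding L_def using circle_integral_resolvent_sums[OF f, of M ?r "axis b 1" a] by simp
  qed
  have "(\<lambda>j. ?a j *\<^sub>m matpow M j) sums (\<chi> a b. L a b)"
    using L unfolding sums_def by (intro vec_tendstoI) simp
  then have s: "(\<lambda>j. ?a j *\<^sub>m matpow M j) sums matfun f M"
    unfolding matfun_def by (simp add: sums_iff)
  \<comment> \<open>Evaluation of a matrix at \<open>x\<close> is linear in finite dimension, hence
    continuous, and passes through the series.\<close>
  have "bounded_linear (\<lambda>N. N *v x :: complex ^ 'n)"
    unfolding linear_conv_bounded_linear[symmetric]
    by (rule linearI) (simp_all add: vec_eq_iff matrix_vector_mult_def scaleR_sum_right sum.distrib ring_distribs)
  from bounded_linear.sums[OF this s] show ?thesis
    by (simp add: smult_matrix_vector)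
qed

theorem matfun_contour_integral:
  fixes M :: "complex ^ 'n ^ 'n"
  assumes f: "f holomorphic_on UNIV"
    and g: "valid_path g" "pathfinish g = pathstart g" "encloses g (mat_spectrum M)"
  shows "(matfun f M *v x) $ i
       = 1 / (2 * of_real pi * \<i>) * contour_integral g (\<lambda>z. f z * (resolvent M z *v x) $ i)"
proof -
  have r: "onorm ((*v) M) < onorm ((*v) M) + 1" by simp
  have "(\<lambda>j. (deriv ^^ j) f 0 / fact j * (matpow M j *v x) $ i) sums (matfun f M *v x) $ i"
    using sums_vec_nth[OF matfun_sums[OF f, of M x], of i] unfolding vector_smult_component .
  from sums_unique2[OF this circle_integral_resolvent_sums[OF f r, of x i]]
  show ?thesis
    by (simp only: contour_integral_enclosing_eq_circle[OF f r g])
qed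

subsection \<open>The phi functions\<close>

lemma phi_0: "phi 0 z = exp z"
  by (simp add: phi_def)

text \<open>Integration by parts in the defining integral of \<open>phi (Suc l)\<close>.\<close>

lemma phi_Suc_recurrence: "z * phi (Suc l) z = phi l z - 1 / fact l"
proof -
  let ?e = "\<lambda>\<theta>::real. exp ((1 - of_real \<theta>) * z)"
  have cont: "continuous_on {0..1} (\<lambda>\<theta>. ?e \<theta> * of_real \<theta> ^ k)" for k
    by (intro continuous_intros)
  have phi_Suc: "fact k * phi (Suc k) z = integral {0..1} (\<lambda>\<theta>. ?e \<theta> * of_real \<theta> ^ k)" for k
    by (simp add: phi_def)
  show ?thesis
  proof (cases l)
    \<comment> \<open>The boundary term at 0 is \<open>exp z\<close> here, whereas for positive
      \<open>l\<close> the power of \<theta> makes it vanish.\<close>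
    case 0
    have "((\<lambda>\<theta>. - z * ?e \<theta>) has_integral (?e 1 - ?e 0)) {0..1}"
      by (intro fundamental_theorem_of_calculus)
        (auto intro!: derivative_eq_intros has_vector_derivative_real_field simp: mult_ac)
    then have "integral {0..1} (\<lambda>\<theta>. - z * ?e \<theta>) = 1 - exp z"
      by (simp only: integral_unique) simp
    then have "- z * integral {0..1} ?e = 1 - exp z"
      by (simp only: integral_mult_right)
    then show ?thesis using 0 phi_Suc[of 0] by (simp add: phi_0 algebra_simps)
  next
    case (Suc k)
    have deriv: "((\<lambda>\<theta>. ?e \<theta> * of_real \<theta> ^ l) has_vector_derivative
        - z * (?e x * of_real x ^ l) + of_nat l * (?e x * of_real x ^ k)) (at x within {0..1})" for x
      by (rule has_vector_derivative_real_field)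
        (auto intro!: derivative_eq_intros simp: algebra_simps Suc; cases k; simp)
    have "((\<lambda>\<theta>. - z * (?e \<theta> * of_real \<theta> ^ l) + of_nat l * (?e \<theta> * of_real \<theta> ^ k))
        has_integral (?e 1 * of_real 1 ^ l - ?e 0 * of_real 0 ^ l)) {0..1}"
      by (intro fundamental_theorem_of_calculus deriv) simp
    then have "1 = integral {0..1} (\<lambda>\<theta>. - z * (?e \<theta> * of_real \<theta> ^ l) + of_nat l * (?e \<theta> * of_real \<theta> ^ k))"
      using Suc by (simp add: integral_unique)
    also have "\<dots> = - z * integral {0..1} (\<lambda>\<theta>. ?e \<theta> * of_real \<theta> ^ l)
        + of_nat l * integral {0..1} (\<lambda>\<theta>. ?e \<theta> * of_real \<theta> ^ k)"
      by (subst integral_add) (auto simp only: integral_mult_right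
          intro!: integrable_continuous_interval continuous_on_mult continuous_on_const cont)
    also have "\<dots> = - z * (fact l * phi (Suc l) z) + of_nat l * (fact k * phi l z)"
      using phi_Suc[of l] phi_Suc[of k] Suc by simp
    finally have "fact l * (z * phi (Suc l) z) = fact l * phi l z - 1"
      using Suc by (simp add: algebra_simps)
    then show ?thesis by (simp add: field_simps)
  qed
qed

text \<open>Supplies the point z = 0 of the power series, where the recurrence cannot be divided by
  z.\<close>

lemma phi_at_0: "phi l 0 = 1 / fact l"
proof (cases l)
  case (Suc k)
  have deriv: "((\<lambda>\<theta>. of_real \<theta> ^ l :: complex) has_vector_derivative of_nat l * of_real x ^ k) (at x within {0..1})" for x
    by (rule has_vector_derivative_real_field)
      (auto intro!: derivative_eq_intros simp: algebra_simps Suc; cases k; simp)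
  have "((\<lambda>\<theta>::real. of_nat l * of_real \<theta> ^ k :: complex) has_integral (of_real 1 ^ l - of_real 0 ^ l)) {0..1}"
    by (intro fundamental_theorem_of_calculus deriv) simp
  then have "of_nat l * integral {0..1} (\<lambda>\<theta>::real. of_real \<theta> ^ k :: complex) = 1"
    using Suc by (simp only: integral_unique flip: integral_mult_right) simp
  then have "fact k * (of_nat l * phi l 0) = 1"
    using Suc by (simp add: phi_def del: of_nat_Suc)
  then show ?thesis using Suc by (simp add: field_simps del: of_nat_Suc)
qed (simp add: phi_0)

text \<open>Induction on \<open>l\<close>: by the recurrence, passing to \<open>Suc l\<close>
  removes the constant term of the series and divides by z.\<close>

lemma phi_sums: "(\<lambda>j. z ^ j / fact (j + l)) sums phi l z"
proof (induction l)
  case 0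
  then show ?case using exp_converges[of z] by (simp add: phi_0 scaleR_conv_of_real divide_inverse mult.commute)
next
  case (Suc l)
  show ?case
  proof (cases "z = 0")
    case True
    then show ?thesis using sums_If_finite_set[of "{0}" "\<lambda>j. 1 / fact (j + Suc l) :: complex"]
      by (simp add: phi_at_0 power_0_left if_distrib[of "\<lambda>a. a / _"] cong: if_cong)
  next
    case False
    have "(\<lambda>j. z ^ Suc j / fact (Suc j + l)) sums (phi l z - 1 / fact l)"
      using Suc by (subst sums_Suc_iff) simp
    then have "(\<lambda>j. z * (z ^ j / fact (j + Suc l))) sums (z * phi (Suc l) z)"
      by (simp add: phi_Suc_recurrence)
    then show ?thesis using False by (subst (asm) sums_mult_iff)
  qed
qed

lemma phi_has_fps_expansion: "phi l has_fps_expansion Abs_fps (\<lambda>j. 1 / fact (j + l))"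
  by (rule has_fps_expansionI) (use phi_sums in simp)

lemma higher_deriv_phi: "(deriv ^^ j) (phi l) 0 / fact j = 1 / fact (j + l)"
  using fps_nth_fps_expansion[OF phi_has_fps_expansion, of l j] by simp

text \<open>An everywhere convergent power series is entire, so the Cauchy formula above applies to
  \<open>phi l\<close> on any enclosing contour.\<close>

lemma holomorphic_on_phi: "phi l holomorphic_on S"
proof -
  have "phi l = (\<lambda>z. \<Sum>j. 1 / fact (j + l) * z ^ j)"
    using phi_sums by (auto simp: sums_iff fun_eq_iff)
  moreover have "summable (\<lambda>j. 1 / fact (j + l) * z ^ j)" for z :: complex
    using phi_sums by (auto simp: sums_iff)
  ultimately have "phi l field_differentiable at z" for z
    using termdiffs_strong_converges_everywhere[of "\<lambda>j. 1 / fact (j + l)" z]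
    by (auto simp: field_differentiable_def)
  then show ?thesis
    by (simp add: holomorphic_on_def field_differentiable_at_within)
qed

lemma has_vector_derivative_vecI:
  fixes f :: "real \<Rightarrow> 'a::real_normed_vector ^ 'n"
  assumes "\<And>i. ((\<lambda>s. f s $ i) has_vector_derivative d $ i) (at t within S)"
  shows "(f has_vector_derivative d) (at t within S)"
  using assms unfolding has_vector_derivative_def has_derivative_at_within
  by (auto intro!: vec_tendstoI bounded_linear_scaleR_left)

subsection \<open>Error and residual\<close>

lemma scaleR_vec_eq_smult: "c *\<^sub>R (x :: complex ^ 'n) = of_real c *s x"
  by (simp add: vec_eq_iff) (simp add: scaleR_conv_of_real)

lemma scaleR_mat_eq_cscale: "c *\<^sub>R (M :: complex ^ 'n ^ 'm) = of_real c *\<^sub>m M"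
  by (simp add: vec_eq_iff cscale_def) (simp add: scaleR_conv_of_real)

section \<open>The differential equation of the phi functions and the residual\<close>

lemma matpow_cscale: "matpow (c *\<^sub>m M) j *v x = c ^ j *s (matpow M j *v x)"
  by (induction j)
    (simp_all add: smult_matrix_vector vec.scale vector_smult_assoc mult.commute flip: matrix_vector_mul_assoc)

lemma matfun_phi_sums:
  "(\<lambda>j. (c ^ j / fact (j + l)) *s (matpow M j *v x)) sums (matfun (phi l) (c *\<^sub>m M) *v x)"
  using matfun_sums[OF holomorphic_on_phi[of l], of "c *\<^sub>m M" x]
  by (simp add: higher_deriv_phi matpow_cscale vector_smult_assoc)

text \<open>Comparing power series coefficients gives z W' + l W = (l / l!) x - z M W. The factor l
  / l! is 0 for l = 0 and 1 / (l-1)! otherwise, which covers both cases of \<open>residual\<close>.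
  The variable is complex so that termwise differentiation applies.\<close>

lemma matfun_phi_has_derivative:
  fixes M :: "complex ^ 'n ^ 'n" and x :: "complex ^ 'n" and l :: nat
  defines "W \<equiv> \<lambda>z. matfun (phi l) ((- z) *\<^sub>m M) *v x"
  assumes "z \<noteq> 0"
  shows "((\<lambda>z. W z $ i) has_field_derivative
    (of_nat l / fact l * x $ i - z * (M *v W z) $ i - of_nat l * W z $ i) / z) (at z)"
proof -
  define c where "c j = (- 1) ^ j / fact (j + l) * (matpow M j *v x) $ i" for j
  define D where "D = (\<Sum>j. diffs c j * z ^ j)"
  have W: "(\<lambda>j. c j * y ^ j) sums (W y $ i)" for y
  proof -
    have "c j * y ^ j = (((- y) ^ j / fact (j + l)) *s (matpow M j *v x)) $ i" for j
      using power_mult_distrib[of "- 1" y j] by (simp add: c_def)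
    then show ?thesis
      using sums_vec_nth[OF matfun_phi_sums[of "- y" l M x], of i] by (simp add: W_def)
  qed
  have "summable (\<lambda>j. diffs c j * z ^ j)"
    by (rule termdiff_converges_all) (use W sums_summable in blast)
  \<comment> \<open>\<open>diffs_equiv\<close> produces the exponent \<open>j - Suc 0\<close>; the
    factor \<open>z\<close> raises it to \<open>j\<close>, and for \<open>j = 0\<close> both sides
    vanish.\<close>
  moreover have "z * (of_nat j * c j * z ^ (j - Suc 0)) = of_nat j * c j * z ^ j" for j
    by (cases j) simp_all
  ultimately have "(\<lambda>j. of_nat j * c j * z ^ j) sums (z * D)"
    using sums_mult[OF diffs_equiv, of c z z] by (simp only: D_def)
  from sums_add[OF this sums_mult[OF W, of "of_nat l" z]]
  have "(\<lambda>j. of_nat (j + l) * c j * z ^ j) sums (z * D + of_nat l * W z $ i)"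
    by (simp add: algebra_simps)
  \<comment> \<open>The term split off at index 0 is the inhomogeneity (l / l!) x.\<close>
  then have "(\<lambda>j. of_nat (Suc j + l) * c (Suc j) * z ^ Suc j) sums (z * D + of_nat l * W z $ i - of_nat l * c 0)"
    by (subst sums_Suc_iff) simp
  \<comment> \<open>The factor \<open>Suc j + l\<close> cancels against the factorial, so the
    shifted series is -z M applied to the original one.\<close>
  moreover have "of_nat (Suc j + l) * c (Suc j) * z ^ Suc j
      = - z * (M *v (((- z) ^ j / fact (j + l)) *s (matpow M j *v x))) $ i" for j
  proof -
    have "of_nat (Suc j + l) * c (Suc j) * z ^ Suc j = - z * (((- 1) ^ j * z ^ j) / fact (j + l)) * (matpow M (Suc j) *v x) $ i"
      unfolding c_def by (simp add: field_simps del: of_nat_Suc of_nat_add matpow_Suc)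
    also have "(- 1) ^ j * z ^ j = (- z) ^ j"
      using power_mult_distrib[of "- 1" z j] by simp
    finally show ?thesis by (simp add: vec.scale flip: matrix_vector_mul_assoc)
  qed
  moreover have "(\<lambda>j. - z * (M *v (((- z) ^ j / fact (j + l)) *s (matpow M j *v x))) $ i)
      sums (- z * (M *v W z) $ i)"
    unfolding W_def
    by (intro sums_mult sums_vec_nth bounded_linear.sums[OF matrix_vector_mul_bounded_linear] matfun_phi_sums)
  ultimately have "z * D + of_nat l * W z $ i - of_nat l * c 0 = - z * (M *v W z) $ i"
    by (simp only: sums_unique2)
  then have "D = (of_nat l / fact l * x $ i - z * (M *v W z) $ i - of_nat l * W z $ i) / z"
    using \<open>z \<noteq> 0\<close> by (simp add: c_def field_simps)
  moreover have "((\<lambda>z. \<Sum>j. c j * z ^ j) has_field_derivative D) (at z)"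
    unfolding D_def by (rule termdiffs_strong_converges_everywhere) (use W sums_summable in blast)
  ultimately show ?thesis
    using W by (simp add: sums_iff)
qed

text \<open>Inserting the differential equation into the residual cancels the source term and the
  term with l / t, leaving only the failure of \<open>V\<close> to intertwine \<open>A\<close> and
  \<open>M\<close>.\<close>

lemma residual_matfun_phi:
  fixes M :: "complex ^ 'k ^ 'k" and V :: "complex ^ 'k ^ 'n" and x :: "complex ^ 'k" and l :: nat
  assumes "t > 0"
  defines "Y \<equiv> \<lambda>s. matfun (phi l) (- (s *\<^sub>R M)) *v x"
  shows "residual l A (V *v x) (\<lambda>s. V *v Y s) t = V *v (M *v Y t) - A *v (V *v Y t)"
proof -
  define D where "D = (\<chi> i. (of_nat l / fact l * x $ i - of_real t * (M *v Y t) $ i - of_nat l * Y t $ i) / of_real t)"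
  have Y: "Y s = matfun (phi l) ((- of_real s) *\<^sub>m M) *v x" for s
    by (simp add: Y_def scaleR_mat_eq_cscale cscale_def vec_eq_iff uminus_vec_def)
  have "((\<lambda>s. Y s $ i) has_vector_derivative D $ i) (at t)" for i
    unfolding Y D_def vec_lambda_beta
    by (rule has_vector_derivative_real_field[OF matfun_phi_has_derivative]) (use \<open>t > 0\<close> in simp)
  then have "(Y has_vector_derivative D) (at t)"
    by (rule has_vector_derivative_vecI)
  from bounded_linear.has_vector_derivative[OF matrix_vector_mul_bounded_linear this, of V]
  have "vector_derivative (\<lambda>s. V *v Y s) (at t) = V *v D"
    by (rule vector_derivative_at)
  moreover have "D = (if l = 0 then 0 else (1 / (t * fact (l - 1))) *\<^sub>R x) - M *v Y t - (real l / t) *\<^sub>R Y t"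
    using \<open>t > 0\<close> by (cases l) (simp_all add: D_def vec_eq_iff scaleR_vec_eq_smult field_simps del: of_nat_Suc)
  ultimately show ?thesis
    by (cases "l = 0")
      (simp_all add: residual_def matrix_vector_mult_diff_distrib vec.neg scaleR_vec_eq_smult vec.scale)
qed

section \<open>The rank-one relation and the error integral\<close>

lemma outer_vector: "outer p q *v x = hinner q x *s p"
  by (simp add: vec_eq_iff outer_def hinner_def matrix_vector_mult_def sum_distrib_left sum_distrib_right mult_ac)

lemma mult_outer: "M ** outer p q = outer (M *v p) q"
  by (simp add: vec_eq_iff outer_def matrix_matrix_mult_def matrix_vector_mult_def sum_distrib_left sum_distrib_right mult_ac)

lemma hinner_e_last: "hinner e_last x = x $ Max UNIV"
  by (simp add: hinner_def e_last_def axis_def if_distrib[of cnj] if_distrib[of "\<lambda>a. a * _"] cong: if_cong)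


lemma matrix_vector_component_basis:
  fixes M :: "complex ^ 'm ^ 'n"
  shows "(\<Sum>j\<in>UNIV. (M *v axis j 1) $ i * x $ j) = (M *v x) $ i"
  by (simp add: matrix_vector_mult_def axis_def if_distrib[of "\<lambda>a. _ * a"] cong: if_cong)

text \<open>Applying zI + tA to \<open>V *v RT u\<close> gives \<open>V *v u\<close> plus a multiple
  of \<open>p\<close>; the resolvent of -tA is then applied to both sides.\<close>

lemma resolvent_intertwining:
  fixes A :: "complex ^ 'n ^ 'n" and T :: "complex ^ 'k ^ 'k" and V :: "complex ^ 'k ^ 'n"
  assumes AV: "\<And>x. A *v (V *v x) = V *v (T *v x) + q x *s p"
    and z: "z \<notin> mat_spectrum (- (t *\<^sub>R A))" "z \<notin> mat_spectrum (- (t *\<^sub>R T))"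
  defines "RA \<equiv> \<lambda>x. resolvent (- (t *\<^sub>R A)) z *v x" and "RT \<equiv> \<lambda>x. resolvent (- (t *\<^sub>R T)) z *v x"
  shows "RA (V *v u) = V *v RT u - (of_real t * q (RT u)) *s RA p"
proof -
  have shift: "(mat z - - (t *\<^sub>R M)) *v x = z *s x + of_real t *s (M *v x)" for M :: "complex ^ 'm ^ 'm" and x
    by (simp add: matrix_vector_mult_add_rdistrib mat_vector_mul scaleR_mat_eq_cscale smult_matrix_vector)
  have "V *v u = V *v ((mat z - - (t *\<^sub>R T)) *v RT u)"
    unfolding RT_def by (simp only: resolvent_cancel(1)[OF z(2)])
  also have "\<dots> = (mat z - - (t *\<^sub>R A)) *v (V *v RT u) - (of_real t * q (RT u)) *s p"
    unfolding shift AV by (simp add: matrix_vector_right_distrib vec.scale vector_add_ldistrib vector_smult_assoc)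
  finally show ?thesis
    unfolding RA_def by (simp only: matrix_vector_mult_diff_distrib resolvent_cancel(2)[OF z(1)] vec.scale)
qed

text \<open>Both matrix functions are integrals over the same contour, so their difference can be
  taken inside, where the intertwining relation turns it into a product of two resolvent
  components.\<close>

lemma matfun_error_contour_integral:
  fixes A :: "complex ^ 'n ^ 'n" and T :: "complex ^ 'k ^ 'k" and V :: "complex ^ 'k ^ 'n"
  assumes AV: "\<And>x. A *v (V *v x) = V *v (T *v x) + x $ m *s p"
    and f: "f holomorphic_on UNIV"
    and g: "valid_path g" "pathfinish g = pathstart g"
      "encloses g (mat_spectrum (- (t *\<^sub>R A)) \<union> mat_spectrum (- (t *\<^sub>R T)))"
  shows "(matfun f (- (t *\<^sub>R A)) *v (V *v u) - V *v (matfun f (- (t *\<^sub>R T)) *v u)) $ i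
    = 1 / (2 * of_real pi * \<i>) * contour_integral g (\<lambda>z.
        - (of_real t * f z * (resolvent (- (t *\<^sub>R T)) z *v u) $ m) * (resolvent (- (t *\<^sub>R A)) z *v p) $ i)"
proof -
  let ?RA = "resolvent (- (t *\<^sub>R A))" and ?RT = "resolvent (- (t *\<^sub>R T))"
  have disj: "path_image g \<inter> mat_spectrum (- (t *\<^sub>R A)) = {}" "path_image g \<inter> mat_spectrum (- (t *\<^sub>R T)) = {}"
    and enc: "encloses g (mat_spectrum (- (t *\<^sub>R A)))" "encloses g (mat_spectrum (- (t *\<^sub>R T)))"
    using g(3) by (auto simp: encloses_def)
  have intA: "(\<lambda>z. f z * (?RA z *v x) $ j) contour_integrable_on g" for x j
    using f g(1) disj(1) by (intro contour_integrable_resolvent[where S = "{}"]) (auto elim: holomorphic_on_subset)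
  have intT: "(\<lambda>z. f z * (?RT z *v x) $ j) contour_integrable_on g" for x j
    using f g(1) disj(2) by (intro contour_integrable_resolvent[where S = "{}"]) (auto elim: holomorphic_on_subset)
  \<comment> \<open>Multiplication by \<open>V\<close> is written as a finite sum over components so
    that it can be moved under the scalar integrals.\<close>
  have "contour_integral g (\<lambda>z. f z * (?RA z *v (V *v u)) $ i) - (\<Sum>j\<in>UNIV. V $ i $ j * contour_integral g (\<lambda>z. f z * (?RT z *v u) $ j))
      = contour_integral g (\<lambda>z. f z * (?RA z *v (V *v u)) $ i - (\<Sum>j\<in>UNIV. V $ i $ j * (f z * (?RT z *v u) $ j)))"
    by (simp add: contour_integral_diff contour_integral_sum contour_integral_lmul contour_integrable_sum
        contour_integrable_lmul intA intT)
  also have "\<dots> = contour_integral g (\<lambda>z. - (of_real t * f z * (?RT z *v u) $ m) * (?RA z *v p) $ i)"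
  proof (rule contour_integral_eq)
    fix z assume "z \<in> path_image g"
    then have z: "z \<notin> mat_spectrum (- (t *\<^sub>R A))" "z \<notin> mat_spectrum (- (t *\<^sub>R T))"
      using disj by auto
    have sum: "(\<Sum>j\<in>UNIV. V $ i $ j * (f z * (?RT z *v u) $ j)) = f z * (V *v (?RT z *v u)) $ i"
      by (simp add: matrix_vector_mult_def[of V] sum_distrib_left mult_ac)
    show "f z * (?RA z *v (V *v u)) $ i - (\<Sum>j\<in>UNIV. V $ i $ j * (f z * (?RT z *v u) $ j))
        = - (of_real t * f z * (?RT z *v u) $ m) * (?RA z *v p) $ i"
      unfolding resolvent_intertwining[OF AV z, of u] sum by (simp add: algebra_simps)
  qed
  finally have diff: "contour_integral g (\<lambda>z. f z * (?RA z *v (V *v u)) $ i)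
      - (\<Sum>j\<in>UNIV. V $ i $ j * contour_integral g (\<lambda>z. f z * (?RT z *v u) $ j))
      = contour_integral g (\<lambda>z. - (of_real t * f z * (?RT z *v u) $ m) * (?RA z *v p) $ i)" .
  moreover have "(V *v (matfun f (- (t *\<^sub>R T)) *v u)) $ i = (\<Sum>j\<in>UNIV. V $ i $ j * (matfun f (- (t *\<^sub>R T)) *v u) $ j)"
    by (simp add: matrix_vector_mult_def[of V])
  ultimately show ?thesis
    unfolding vector_minus_component matfun_contour_integral[OF f g(1,2) enc(1)]
      matfun_contour_integral[OF f g(1,2) enc(2)] diff[symmetric]
    by (simp only: right_diff_distrib sum_distrib_left mult.left_commute)
qed

text \<open>The matrix integral is entrywise, so its product with \<open>x\<close> is a finite sum
  of scalar integrals; integrability lets the sum pass inside.\<close>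

lemma matrix_contour_integral_resolvent_vector:
  fixes A :: "complex ^ 'n ^ 'n"
  assumes "\<And>x j. (\<lambda>z. F z * (resolvent A z *v x) $ j) contour_integrable_on g"
  shows "(matrix_contour_integral g (\<lambda>z. F z *\<^sub>m resolvent A z) *v x) $ i
    = contour_integral g (\<lambda>z. F z * (resolvent A z *v x) $ i)"
proof -
  have entry: "(F z *\<^sub>m resolvent A z) $ i $ j = F z * (resolvent A z *v axis j 1) $ i" for z j
    by (simp add: cscale_def matrix_vector_mult_def axis_def if_distrib[of "\<lambda>a. _ * a"] cong: if_cong)
  have "(matrix_contour_integral g (\<lambda>z. F z *\<^sub>m resolvent A z) *v x) $ i
      = (\<Sum>j\<in>UNIV. contour_integral g (\<lambda>z. F z * (resolvent A z *v axis j 1) $ i) * x $ j)"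
    unfolding matrix_contour_integral_def matrix_vector_mult_def[of "vec_lambda _"] by (simp only: vec_lambda_beta entry)
  also have "\<dots> = contour_integral g (\<lambda>z. \<Sum>j\<in>UNIV. F z * (resolvent A z *v axis j 1) $ i * x $ j)"
    by (simp add: contour_integral_sum contour_integral_rmul contour_integrable_rmul assms)
  also have "\<dots> = contour_integral g (\<lambda>z. F z * (resolvent A z *v x) $ i)"
    unfolding matrix_vector_component_basis[symmetric, where i = i and x = x] by (simp only: sum_distrib_left mult.assoc)
  finally show ?thesis .
qed

theorem theorem4p4:
  fixes A :: "complex ^ 'n ^ 'n" and v w :: "complex ^ 'n"
    and V :: "complex ^ ('k :: {finite, linorder}) ^ 'n" and H T :: "complex ^ ('k :: {finite, linorder}) ^ ('k :: {finite, linorder})"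
    and h \<beta> \<gamma> t :: real and l :: nat and \<Gamma> :: "real \<Rightarrow> complex"
    and y yhat err res :: "real \<Rightarrow> complex ^ 'n" and E :: "complex ^ 'n ^ 'n"
  assumes "t > 0"
    and "\<forall>z\<in>mat_spectrum (- (t *\<^sub>R A)). Re z \<le> 0"
    and "v \<noteq> 0" and "\<beta> = norm v"
    and "arnoldi A ((1 / \<beta>) *\<^sub>R v) V w H h"
    and "\<gamma> \<noteq> 0" and "invertible (mat 1 + \<gamma> *\<^sub>R H)"
    and "T = H + (\<gamma> * h\<^sup>2) *\<^sub>R (matrix_inv (ctranspose (mat 1 + \<gamma> *\<^sub>R H)) ** outer e_last e_last)"
    and "y = (\<lambda>s. matfun (phi l) (- (s *\<^sub>R A)) *v v)"
    and "yhat = (\<lambda>s. V *v (matfun (phi l) (- (s *\<^sub>R T)) *v (\<beta> *\<^sub>R e_first)))"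
    and "err = (\<lambda>s. y s - yhat s)"
    and "res = residual l A v yhat"
    and "valid_path \<Gamma>" and "pathfinish \<Gamma> = pathstart \<Gamma>"
    and "encloses \<Gamma> (mat_spectrum (- (t *\<^sub>R A)) \<union> mat_spectrum (- (t *\<^sub>R T)))"
    and "phi l analytic_on (path_image \<Gamma> \<union> inside (path_image \<Gamma>))"
    and "hinner e_last (matfun (phi l) (- (t *\<^sub>R T)) *v (\<beta> *\<^sub>R e_first)) \<noteq> 0"
    and "E = (1 / (2 * of_real pi * \<i>)) *\<^sub>m
           matrix_contour_integral \<Gamma> (\<lambda>z. f_fun l t \<beta> T z *\<^sub>m matrix_inv (mat z + t *\<^sub>R A))"
  shows "err t = E *v res t \<and> norm (err t) \<le> onorm (\<lambda>x. E *v x) * norm (res t)"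
proof -
  note AL = assms(5)[unfolded arnoldi_def]
  let ?m = "Max (UNIV :: 'k set)" and ?G = "matrix_inv (ctranspose (mat 1 + \<gamma> *\<^sub>R H))"
  let ?RA = "resolvent (- (t *\<^sub>R A))" and ?RT = "resolvent (- (t *\<^sub>R T))"
  define u :: "complex ^ ('k :: {finite, linorder})" where "u = \<beta> *\<^sub>R e_first"
  \<comment> \<open>The Arnoldi remainder contributes \<open>h *\<^sub>R w\<close>; the second term
    compensates for replacing \<open>H\<close> by \<open>T\<close>, whose correction is also
    supported on the last coordinate.\<close>
  define p where "p = h *\<^sub>R w - (\<gamma> * h\<^sup>2) *\<^sub>R (V *v (?G *v e_last))"
  define c where "c = (matfun (phi l) (- (t *\<^sub>R T)) *v u) $ ?m"
  define F where "F = f_fun l t \<beta> T"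
  have "c \<noteq> 0"
    using assms(17) by (simp add: c_def u_def hinner_e_last)
  have AV: "A *v (V *v x) = V *v (T *v x) + x $ ?m *s p" for x
  proof -
    have "A *v (V *v x) = V *v (H *v x) + (h *\<^sub>R outer w e_last) *v x"
      using AL by (simp add: matrix_vector_mul_assoc matrix_vector_mult_add_rdistrib)
    moreover have "T *v x = H *v x + of_real (\<gamma> * h\<^sup>2) *s (x $ ?m *s (?G *v e_last))"
      unfolding assms(8) mult_outer scaleR_mat_eq_cscale
      by (simp only: matrix_vector_mult_add_rdistrib smult_matrix_vector outer_vector hinner_e_last)
    then have "V *v (T *v x) = V *v (H *v x) + of_real (\<gamma> * h\<^sup>2) *s (x $ ?m *s (V *v (?G *v e_last)))"
      by (simp only: matrix_vector_right_distrib vec.scale)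
    ultimately show ?thesis
      by (simp add: p_def scaleR_mat_eq_cscale scaleR_vec_eq_smult smult_matrix_vector outer_vector hinner_e_last
          vec_eq_iff algebra_simps)
  qed
  have "V *v u = v"
  proof -
    have "V *v e_first = (1 / \<beta>) *\<^sub>R v"
      using AL by (simp add: e_first_def matrix_vector_mult_def column_def axis_def if_distrib[of "\<lambda>a. _ * a"] cong: if_cong)
    then show ?thesis
      using assms(3,4) by (simp add: u_def scaleR_vec_eq_smult vec.scale vector_smult_assoc)
  qed
  \<comment> \<open>By \<open>AV\<close>, the intertwining failure is the last component of
    \<phi>(-tT) u, which is \<open>c\<close>, times \<open>p\<close>.\<close>
  have res: "res t = - (c *s p)"
    using residual_matfun_phi[OF assms(1), of l A V u T] AV \<open>V *v u = v\<close>
    by (simp add: assms(10,12) c_def u_def)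
  have disj: "path_image \<Gamma> \<inter> mat_spectrum (- (t *\<^sub>R A)) = {}" "path_image \<Gamma> \<inter> mat_spectrum (- (t *\<^sub>R T)) = {}"
    using assms(15) by (auto simp: encloses_def)
  have F: "F z = of_real t * phi l z * ((?RT z *v u) $ ?m / c)" for z
    by (simp add: F_def f_fun_def resolvent_def hinner_e_last c_def u_def)
  have "F holomorphic_on - mat_spectrum (- (t *\<^sub>R T))"
    unfolding F using \<open>c \<noteq> 0\<close> by (intro holomorphic_intros holomorphic_on_phi holomorphic_on_resolvent) auto
  then have int: "(\<lambda>z. F z * (?RA z *v x) $ j) contour_integrable_on \<Gamma>" for x j
    using disj by (intro contour_integrable_resolvent[OF finite_mat_spectrum] assms(13))
  have E: "E = (1 / (2 * of_real pi * \<i>)) *\<^sub>m matrix_contour_integral \<Gamma> (\<lambda>z. F z *\<^sub>m ?RA z)"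
    by (simp add: assms(18) F_def resolvent_def)
  have "err t = E *v res t"
  proof (rule vec_eq_iff[THEN iffD2, rule_format])
    fix i
    \<comment> \<open>The normalising denominator \<open>c\<close> of \<open>F\<close> cancels the
      factor \<open>c\<close> of the residual, which leaves the integrand of the error
      formula.\<close>
    have "F z * (?RA z *v res t) $ i = - (of_real t * phi l z * (?RT z *v u) $ ?m) * (?RA z *v p) $ i" for z
      using \<open>c \<noteq> 0\<close> by (simp add: F res vec.neg vec.scale)
    then have "(E *v res t) $ i = 1 / (2 * of_real pi * \<i>) *
        contour_integral \<Gamma> (\<lambda>z. - (of_real t * phi l z * (?RT z *v u) $ ?m) * (?RA z *v p) $ i)"
      unfolding E smult_matrix_vector vector_smult_component matrix_contour_integral_resolvent_vector[OF int]
      by (simp only:)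
    also have "\<dots> = err t $ i"
      unfolding matfun_error_contour_integral[OF AV holomorphic_on_phi assms(13-15), symmetric]
      by (simp add: assms(9-11) \<open>V *v u = v\<close> flip: u_def)
    finally show "err t $ i = (E *v res t) $ i" by (rule sym)
  qed
  then show ?thesis
    using onorm[OF matrix_vector_mul_bounded_linear, of E "res t"] by simp
qed

end
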